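(* Let $N,k,j$ be positive integers with $j(k+1)\le N$, and let $\phi_{k,j}\in\mathbb{R}^N$ be the periodic $k$-th order finite difference vector of scale $j$. Then the discrete Fourier transform of $\phi_{k,j}$ is given by $$F(\phi_{k,j})_\xi=\frac{\left(e^{\frac{i2\pi\xi j}{N}}-1\right)^{k+1}}{e^{\frac{i2\pi\xi}{N}}-1},\qquad \xi=0,1,\dots,N-1,$$ where for $\xi=0$ the right-hand side is understood as its limiting value as $\xi\to0$, namely $0$.
   Context: Vectors in $\mathbb{R}^N$ are indexed by $m=0,1,\dots,N-1$. The vector $\phi_{k,j}\in\mathbb{R}^N$ is defined by $$(\phi_{k,j})_m=\begin{cases}(-1)^k & \text{if } m=0,\\ 0 & \text{if } 1\le m\le N-j(k+1),\\ (-1)^{k+\lfloor\frac{N-m}{j}\rfloor}\binom{k}{\lfloor\frac{N-m}{j}\rfloor} & \text{if } N-j(k+1)<m<N.\end{cases}$$ The discrete Fourier transform of $f\in\mathbb{R}^N$ is $F(f)_\xi=\sum_{n=0}^{N-1}f_n\,e^{-\frac{i2\pi}{N}n\xi}$ for $\xi=0,1,\dots,N-1$, where $i$ is the imaginary unit. *)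

theory Defs
  imports Complex_Main "Jordan_Normal_Form.Matrix"
begin

text \<open>
  Vectors in dimension \<open>N\<close> are indexed by \<open>0, \<dots>, N - 1\<close>, as in \<^typ>\<open>real vec\<close>.
  The last branch below is the range \<open>N - j * (k + 1) < m < N\<close>; the truncated subtraction
  \<open>N - j * (k + 1)\<close> agrees with the integer one when \<open>j * (k + 1) \<le> N\<close>, and \<open>div\<close> is the floor
  of the quotient.
\<close>

definition diff_vec :: "nat \<Rightarrow> nat \<Rightarrow> nat \<Rightarrow> real vec" where
  "diff_vec N k j = vec N (\<lambda>m.
     if m = 0 then (-1) ^ k
     else if m \<le> N - j * (k + 1) then 0
     else (-1) ^ (k + (N - m) div j) * real (k choose ((N - m) div j)))"

definition dft :: "real vec \<Rightarrow> complex vec" where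
  "dft f = (let N = dim_vec f in vec N (\<lambda>\<xi>.
     \<Sum>n = 0..<N. complex_of_real (f $ n) *
       exp (- (\<i> * 2 * complex_of_real pi / of_nat N) * of_nat n * of_nat \<xi>)))"

text \<open>
  The quotient is a function of a real frequency, so that its limit at \<open>0\<close> can be stated;
  at \<open>0\<close> itself both numerator and denominator vanish.
\<close>

definition diff_symbol :: "nat \<Rightarrow> nat \<Rightarrow> nat \<Rightarrow> real \<Rightarrow> complex" where
  "diff_symbol N k j \<xi> =
     (exp (\<i> * 2 * complex_of_real pi * complex_of_real \<xi> * of_nat j / of_nat N) - 1) ^ (k + 1) /
     (exp (\<i> * 2 * complex_of_real pi * complex_of_real \<xi> / of_nat N) - 1)"

end

theory Submission
  imports Defs
begin

text \<open>
  Put \<open>w = exp (2 \<pi> \<i> \<xi> / N)\<close>. Since \<open>w ^ N = 1\<close>, the Fourier sum may be read backwards: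
  the index \<open>m\<close> contributes \<open>w ^ l\<close> with \<open>l = N - m\<close> taken modulo \<open>N\<close>. In the variable \<open>l\<close>
  the difference vector has the uniform entries \<open>(-1) ^ (k + l div j) * (k choose (l div j))\<close> for
  all \<open>l < N\<close>, because the binomial coefficient vanishes by itself once \<open>l \<ge> j * (k + 1)\<close>
  (lemma \<open>dft_diff_vec\<close>). These entries are constant on blocks of length \<open>j\<close>, so the sum factors
  as a binomial sum in \<open>w ^ j\<close> times one geometric block (lemma \<open>sum_blocks\<close>), which gives the
  polynomial \<open>(w ^ j - 1) ^ k * (\<Sum>r<j. w ^ r)\<close> in \<open>w\<close>.

  The geometric block is \<open>(w ^ j - 1) / (w - 1)\<close> when \<open>w \<noteq> 1\<close>, so the polynomial is the symbol.
  When \<open>w = 1\<close> the polynomial vanishes because \<open>k > 0\<close>, and so does the symbol, as a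
  quotient by \<open>0\<close>. Hence the two agree at every real frequency
  (lemma \<open>diff_symbol_eq\<close>), and the limit at \<open>0\<close> is the value of a continuous function.
\<close>

text \<open>Coefficients constant on blocks: write \<open>l = q * j + r\<close> with \<open>r < j\<close>.\<close>

lemma sum_blocks:
  fixes c :: "nat \<Rightarrow> 'a::comm_ring_1"
  shows "(\<Sum>l<n * j. c (l div j) * w ^ l) = (\<Sum>q<n. c q * (w ^ j) ^ q) * (\<Sum>r<j. w ^ r)"
proof -
  have block: "(\<Sum>l = q * j..<q * j + j. c (l div j) * w ^ l) = c q * (w ^ j) ^ q * (\<Sum>r<j. w ^ r)"
    for q
  proof -
    have "(\<Sum>l = q * j..<q * j + j. c (l div j) * w ^ l)
        = (\<Sum>r = 0..<j. c ((r + q * j) div j) * w ^ (r + q * j))"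
      using sum.shift_bounds_nat_ivl[of "\<lambda>l. c (l div j) * w ^ l" 0 "q * j" j]
      by (simp add: add.commute)
    also have "\<dots> = (\<Sum>r = 0..<j. c q * (w ^ j) ^ q * w ^ r)"
      by (intro sum.cong refl) (simp add: power_add power_mult[symmetric] mult_ac)
    finally show ?thesis
      by (simp add: sum_distrib_left atLeast0LessThan)
  qed
  have "(\<Sum>l<n * j. c (l div j) * w ^ l) = (\<Sum>q<n. \<Sum>l = q * j..<q * j + j. c (l div j) * w ^ l)"
    by (rule sum.nat_group[symmetric])
  then show ?thesis
    by (simp add: block sum_distrib_right)
qed

lemma alternating_binomial_sum:
  fixes z :: "'a::comm_ring_1"
  shows "(\<Sum>q\<le>k. (-1) ^ (k + q) * of_nat (k choose q) * z ^ q) = (z - 1) ^ k"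
proof -
  have sign: "(-1) ^ (k + q) = ((-1) ^ (k - q) :: 'a)" if "q \<le> k" for q
  proof -
    have "k + q = (k - q) + 2 * q" using that by simp
    then show ?thesis by (simp only: power_add power_mult) simp
  qed
  have "(z - 1) ^ k = (\<Sum>q\<le>k. of_nat (k choose q) * z ^ q * (-1) ^ (k - q))"
    using binomial_ring[of z "-1" k] by simp
  also have "\<dots> = (\<Sum>q\<le>k. (-1) ^ (k + q) * of_nat (k choose q) * z ^ q)"
    by (intro sum.cong refl) (simp add: sign mult_ac)
  finally show ?thesis ..
qed

text \<open>
  Keeping the geometric sum instead of a quotient lets the formula cover \<open>\<xi> = 0\<close>, where \<open>w = 1\<close>.
\<close>

lemma dft_diff_vec:
  fixes N k j \<xi> :: nat
  defines "w \<equiv> exp (\<i> * 2 * complex_of_real pi * of_nat \<xi> / of_nat N)"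
  assumes N: "N > 0" and j: "j > 0" and le: "j * (k + 1) \<le> N" and \<xi>: "\<xi> < N"
  shows "dft (diff_vec N k j) $ \<xi> = (w ^ j - 1) ^ k * (\<Sum>r<j. w ^ r)"
proof -
  define c :: "nat \<Rightarrow> complex" where "c q = (-1) ^ (k + q) * of_nat (k choose q)" for q
  define a where "a l = c (l div j) * w ^ l" for l
  define t where "t n = complex_of_real (diff_vec N k j $ n) *
      exp (- (\<i> * 2 * complex_of_real pi / of_nat N) * of_nat n * of_nat \<xi>)" for n
  have c0: "c q = 0" if "k < q" for q
    using that by (simp add: c_def)
  have wN: "w ^ N = 1"
  proof -
    have "w ^ N = exp (of_nat N * (\<i> * 2 * complex_of_real pi * of_nat \<xi> / of_nat N))"
      by (simp only: w_def exp_of_nat_mult)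
    also have "\<dots> = exp (of_nat \<xi> * (2 * of_real pi * \<i>))"
      using N by (intro arg_cong[where f = exp]) (simp add: mult_ac)
    also have "\<dots> = 1"
      by (simp only: exp_of_nat_mult exp_two_pi_i power_one)
    finally show ?thesis .
  qed
  have expn: "exp (- (\<i> * 2 * complex_of_real pi / of_nat N) * of_nat n * of_nat \<xi>) = w ^ (N - n)"
    if "n \<le> N" for n
  proof -
    have "exp (- (\<i> * 2 * complex_of_real pi / of_nat N) * of_nat n * of_nat \<xi>) = inverse (w ^ n)"
      by (simp add: w_def exp_of_nat_mult[symmetric] exp_minus[symmetric] mult_ac)
    moreover have "w ^ n * w ^ (N - n) = 1"
      using wN that by (simp add: power_add[symmetric])
    ultimately show ?thesis
      by (simp add: inverse_unique)
  qed
  have t0: "t 0 = a 0"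
    using N by (simp add: t_def a_def c_def diff_vec_def)
  have t1: "t n = a (N - n)" if n: "0 < n" "n < N" for n
  proof (cases "n \<le> N - j * (k + 1)")
    case True
    \<comment> \<open>On the zero stretch the block number exceeds \<open>k\<close>, so the binomial coefficient is \<open>0\<close> too.\<close>
    then have "(k + 1) * j \<le> N - n" using le n by (simp add: mult.commute)
    then have "k < (N - n) div j"
      using j by (simp add: less_eq_div_iff_mult_less_eq Suc_le_eq[symmetric])
    then show ?thesis using True n by (simp add: t_def a_def c0 diff_vec_def)
  next
    case False
    then show ?thesis using n expn[of n]
      by (simp add: t_def a_def c_def diff_vec_def)
  qed
  have "dft (diff_vec N k j) $ \<xi> = (\<Sum>n = 0..<N. t n)"
    using \<xi> by (simp add: dft_def t_def Let_def diff_vec_def)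
  also have "\<dots> = t 0 + (\<Sum>n = 1..<N. t n)"
    using N by (simp add: sum.atLeast_Suc_lessThan)
  also have "(\<Sum>n = 1..<N. t n) = (\<Sum>l = 1..<N. a l)"
    by (rule sum.reindex_bij_witness[where i = "\<lambda>l. N - l" and j = "\<lambda>n. N - n"]) (auto simp: t1)
  also have "t 0 + \<dots> = (\<Sum>l<N. a l)"
    using N by (simp add: t0 sum.atLeast_Suc_lessThan lessThan_atLeast0)
  also have "\<dots> = (\<Sum>l<(k + 1) * j. a l)"
  proof (rule sum.mono_neutral_right)
    show "\<forall>l\<in>{..<N} - {..<(k + 1) * j}. a l = 0"
    proof
      fix l assume "l \<in> {..<N} - {..<(k + 1) * j}"
      then have "k < l div j"
        using j by (simp add: less_eq_div_iff_mult_less_eq Suc_le_eq[symmetric])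
      then show "a l = 0" by (simp add: a_def c0)
    qed
  qed (use le in \<open>auto simp: mult.commute\<close>)
  also have "\<dots> = (\<Sum>q<k + 1. c q * (w ^ j) ^ q) * (\<Sum>r<j. w ^ r)"
    unfolding a_def by (rule sum_blocks)
  also have "(\<Sum>q<k + 1. c q * (w ^ j) ^ q) = (w ^ j - 1) ^ k"
    using alternating_binomial_sum[of k "w ^ j"] by (simp add: c_def lessThan_Suc_atMost)
  finally show ?thesis .
qed

text \<open>
  No frequency is excluded: where \<open>w = 1\<close> the right-hand side has the factor \<open>0 ^ k\<close>
  with \<open>k > 0\<close>, which matches the convention \<open>x / 0 = 0\<close> on the left.
\<close>

lemma diff_symbol_eq:
  fixes N :: nat and x :: real
  defines "w \<equiv> exp (\<i> * 2 * complex_of_real pi * complex_of_real x / of_nat N)"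
  assumes "k > 0"
  shows "diff_symbol N k j x = (w ^ j - 1) ^ k * (\<Sum>r<j. w ^ r)"
proof -
  have "exp (\<i> * 2 * complex_of_real pi * complex_of_real x * of_nat j / of_nat N) = w ^ j"
    by (simp add: w_def exp_of_nat_mult[symmetric] mult_ac)
  then have symbol: "diff_symbol N k j x = (w ^ j - 1) ^ (k + 1) / (w - 1)"
    by (simp add: diff_symbol_def w_def)
  show ?thesis
  proof (cases "w = 1")
    case True
    then show ?thesis using \<open>k > 0\<close> by (simp add: symbol)
  next
    case False
    have "(w ^ j - 1) ^ (k + 1) = (w ^ j - 1) ^ k * (\<Sum>r<j. w ^ r) * (w - 1)"
      by (simp add: power_diff_1_eq[of w j] mult_ac)
    then show ?thesis using False by (simp only: symbol) simp
  qed
qed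

theorem proposition1:
  fixes N k j :: nat
  assumes "N > 0" and "k > 0" and "j > 0" and "j * (k + 1) \<le> N"
  shows "(diff_symbol N k j \<longlongrightarrow> 0) (at 0) \<and>
         (\<forall>\<xi><N. dft (diff_vec N k j) $ \<xi> =
           (if \<xi> = 0 then 0 else diff_symbol N k j (real \<xi>)))"
proof (intro conjI allI impI)
  define w where "w x = exp (\<i> * 2 * complex_of_real pi * complex_of_real x / of_nat N)" for x
  have "isCont (\<lambda>x. (w x ^ j - 1) ^ k * (\<Sum>r<j. w x ^ r)) 0"
    unfolding w_def using \<open>N > 0\<close> by (intro continuous_intros) auto
  then have "((\<lambda>x. (w x ^ j - 1) ^ k * (\<Sum>r<j. w x ^ r)) \<longlongrightarrow> 0) (at 0)"
    using \<open>k > 0\<close> by (simp add: isCont_def w_def zero_power)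
  moreover have "diff_symbol N k j = (\<lambda>x. (w x ^ j - 1) ^ k * (\<Sum>r<j. w x ^ r))"
    using diff_symbol_eq[OF \<open>k > 0\<close>] by (auto simp: w_def)
  ultimately show "(diff_symbol N k j \<longlongrightarrow> 0) (at 0)"
    by simp
next
  fix \<xi> assume "\<xi> < N"
  then have "dft (diff_vec N k j) $ \<xi> = diff_symbol N k j (real \<xi>)"
    using assms by (simp add: dft_diff_vec diff_symbol_eq)
  moreover have "diff_symbol N k j 0 = 0"
    by (simp add: diff_symbol_def)
  ultimately show "dft (diff_vec N k j) $ \<xi> =
      (if \<xi> = 0 then 0 else diff_symbol N k j (real \<xi>))"
    by simp
qed

end
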